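(* Consider the convexified disjunction $$\bigvee_{l\in\mathcal D}\Big[\ \operatorname{convenv}_{\mathcal B}\Big(\sum_{i=1}^nh_{i,k}(x_i)\Big)\le b_{l,k}\ \ \forall k\in\mathcal C_l,\quad \boldsymbol x\in\mathcal B\ \Big],$$ where the $h_{i,k}$ may be nonconvex. When applied to this disjunction, a $1$-split formulation is equivalent to the big-M formulation, i.e. their continuous relaxations have the same projection onto the $\boldsymbol x$-space. Furthermore, if the bounds on the $\alpha$-variables are additive, then splitting one group of variables in a $P$-split formulation into two groups, to form a $(P+1)$-split formulation, results in an as tight or tighter continuous relaxation, i.e. the projection onto the $\boldsymbol x$-space of the continuous relaxation of the $(P+1)$-split formulation is contained in that of the $P$-split formulation.
   Context: Setting. $\mathcal B\subset\mathbb R^n$ is a bounded box defined by the variables' lower and upper bounds, $\mathcal D$ is a finite set of disjunct indices, $\mathcal C_l$ is the finite set of constraint indices in disjunct $l\in\mathcal D$, $b_{l,k}\in\mathbb R$, and $h_{i,k}:\mathbb R\to\mathbb R$ are functions (not necessarily convex) bounded over $\mathcal B$; each disjunct is non-empty. $\operatorname{convenv}_{\mathcal B}(f)$ denotes the convex envelope of $f$ over $\mathcal B$, i.e. the pointwise largest convex function on $\mathcal B$ not exceeding $f$. $P$-split formulation of the convexified disjunction. Let $\mathcal I_1,\dots,\mathcal I_P$ be a partition of $\{1,\dots,n\}$ into $P$ pairwise disjoint non-empty sets. Write $H_{s,k}(\boldsymbol x)=\operatorname{convenv}_{\mathcal B}\big(\sum_{i\in\mathcal I_s}h_{i,k}(x_i)\big)$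 and let $\underline\alpha^{l,k}_s$, $\bar\alpha^{l,k}_s$ be the minimum (infimum) and maximum (supremum) of $H_{s,k}$ over $\mathcal B$. The formulation has variables $\boldsymbol x\in\mathcal B$, $\alpha^{l,k}_s\in\mathbb R$, $\nu^{\alpha^{l,k}_s}_d\in\mathbb R$ ($d\in\mathcal D$), $\boldsymbol\lambda\in\{0,1\}^{|\mathcal D|}$ and constraints, for all $s\in\{1,\dots,P\}$, $l,d\in\mathcal D$, $k\in\mathcal C_l$: $$\alpha^{l,k}_s=\sum_{d'\in\mathcal D}\nu^{\alpha^{l,k}_s}_{d'},\quad \sum_{s'=1}^P\nu^{\alpha^{l,k}_{s'}}_l\le b_{l,k}\lambda_l,\quad \underline{\alpha}^{l,k}_s\lambda_d\le\nu^{\alpha^{l,k}_s}_d\le\bar\alpha^{l,k}_s\lambda_d,\quad H_{s,k}(\boldsymbol x)\le\alpha^{l,k}_s,\quad \sum_{l'\in\mathcal D}\lambda_{l'}=1.$$ Big-M formulation. Variables $\boldsymbol x\in\mathcal B$, $\boldsymbol\lambda\in\{0,1\}^{|\mathcal D|}$ with $\sum_{l\in\mathcal D}\lambda_l=1$ and $\operatorname{convenv}_{\mathcal B}\big(\sum_{i=1}^nh_{i,k}(x_i)\big)\le b_{l,k}+M^{l,k}(1-\lambda_l)$ for all $l\in\mathcal D$, $k\in\mathcal C_l$, where $M^{l,k}$ is the smallest valid coefficient, namely the maximum (supremum) over $\mathcal B$ of $\operatorname{convenv}_{\mathcal B}\big(\sum_{i=1}^nh_{i,k}(x_i)\big)$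 minus $b_{l,k}$. The continuous relaxation of either formulation replaces $\boldsymbol\lambda\in\{0,1\}^{|\mathcal D|}$ by $\boldsymbol\lambda\in[0,1]^{|\mathcal D|}$. Additive bounds. For every $k$ and all disjoint $\mathcal I,\mathcal I'\subset\{1,\dots,n\}$, the minimum over $\mathcal B$ of $\operatorname{convenv}_{\mathcal B}(\sum_{i\in\mathcal I}h_{i,k}(x_i))+\operatorname{convenv}_{\mathcal B}(\sum_{i\in\mathcal I'}h_{i,k}(x_i))$ equals the sum of the minima over $\mathcal B$ of the two summands, and likewise for maxima. *)

theory Defs
  imports "HOL-Analysis.Analysis"
begin

text \<open>
  The convex envelope of \<open>f\<close> over \<open>S\<close>: the pointwise largest convex function on \<open>S\<close> not
  exceeding \<open>f\<close>.  It is meaningful at points of \<open>S\<close> and when \<open>f\<close> is bounded below on \<open>S\<close>;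
  the three lemmas below then confirm that it is the largest convex minorant.
\<close>

definition convenv :: "'a::real_vector set \<Rightarrow> ('a \<Rightarrow> real) \<Rightarrow> 'a \<Rightarrow> real" where
  "convenv S f x = (SUP g \<in> {g. convex_on S g \<and> (\<forall>y\<in>S. g y \<le> f y)}. g x)"

lemma convenv_greatest:
  assumes "convex_on S g" "\<And>y. y \<in> S \<Longrightarrow> g y \<le> f y" "x \<in> S"
  shows "g x \<le> convenv S f x"
  unfolding convenv_def
  by (rule cSUP_upper) (use assms in \<open>auto intro!: bdd_aboveI2[where M = "f x"]\<close>)

lemma
  assumes "convex S" "bdd_below (f ` S)"
  shows convenv_le: "x \<in> S \<Longrightarrow> convenv S f x \<le> f x"
    and convex_on_convenv: "convex_on S (convenv S f)"
proof -
  let ?G = "{g. convex_on S g \<and> (\<forall>y\<in>S. g y \<le> f y)}"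
  obtain m where "\<And>y. y \<in> S \<Longrightarrow> m \<le> f y"
    using assms(2) by (auto simp: bdd_below_def)
  then have "(\<lambda>_. m) \<in> ?G"
    using assms(1) by (auto simp: convex_on_def simp flip: distrib_right)
  then have ne: "?G \<noteq> {}" by blast
  show "convenv S f x \<le> f x" if "x \<in> S" for x
    unfolding convenv_def by (rule cSUP_least[OF ne]) (use that in auto)
  show "convex_on S (convenv S f)"
  proof (rule convex_onI[OF _ assms(1)])
    fix t :: real and x y
    assume t: "0 < t" "t < 1" and xy: "x \<in> S" "y \<in> S"
    have "g ((1 - t) *\<^sub>R x + t *\<^sub>R y) \<le> (1 - t) * convenv S f x + t * convenv S f y"
      if "g \<in> ?G" for g
    proof -
      have "g ((1 - t) *\<^sub>R x + t *\<^sub>R y) \<le> (1 - t) * g x + t * g y"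
        using that t xy by (auto intro!: convex_onD)
      also have "\<dots> \<le> (1 - t) * convenv S f x + t * convenv S f y"
        using that t xy by (intro add_mono mult_left_mono convenv_greatest) auto
      finally show ?thesis .
    qed
    then show "convenv S f ((1 - t) *\<^sub>R x + t *\<^sub>R y)
        \<le> (1 - t) * convenv S f x + t * convenv S f y"
      by (subst convenv_def) (rule cSUP_least[OF ne])
  qed
qed

definition env_sum ::
    "(real^'n) set \<Rightarrow> ('n \<Rightarrow> 'k \<Rightarrow> real \<Rightarrow> real) \<Rightarrow> 'n set \<Rightarrow> 'k \<Rightarrow> real^'n \<Rightarrow> real" where
  "env_sum B h I k = convenv B (\<lambda>x. \<Sum>i\<in>I. h i k (x $ i))"

definition disjunct ::
    "(real^'n) set \<Rightarrow> ('n \<Rightarrow> 'k \<Rightarrow> real \<Rightarrow> real) \<Rightarrow> ('d \<Rightarrow> 'k set) \<Rightarrow> ('d \<Rightarrow> 'k \<Rightarrow> real)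
      \<Rightarrow> 'd \<Rightarrow> (real^'n) set" where
  "disjunct B h C b l = {x \<in> B. \<forall>k \<in> C l. env_sum B h UNIV k x \<le> b l k}"

definition is_split :: "nat \<Rightarrow> (nat \<Rightarrow> 'n set) \<Rightarrow> bool" where
  "is_split P I \<longleftrightarrow>
     disjoint_family_on I {1..P} \<and> (\<forall>s\<in>{1..P}. I s \<noteq> {}) \<and> (\<Union>s\<in>{1..P}. I s) = UNIV"

text \<open>
  The numbering of the groups of the finer split \<open>J\<close> is arbitrary: groups \<open>t\<close> and \<open>u\<close> of \<open>J\<close> are
  the two parts of group \<open>j\<close> of \<open>I\<close>, and the remaining groups of \<open>I\<close> and \<open>J\<close> are the same sets.
\<close>

definition splits_one_group :: "nat \<Rightarrow> (nat \<Rightarrow> 'n set) \<Rightarrow> (nat \<Rightarrow> 'n set) \<Rightarrow> bool" where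
  "splits_one_group P I J \<longleftrightarrow>
     is_split P I \<and> is_split (P + 1) J \<and>
     (\<exists>j\<in>{1..P}. \<exists>t\<in>{1..P+1}. \<exists>u\<in>{1..P+1}. t \<noteq> u \<and> J t \<union> J u = I j \<and>
        J ` ({1..P+1} - {t, u}) = I ` ({1..P} - {j}))"

text \<open>
  Feasible points are tuples of all the variables of a formulation: \<open>\<alpha> s l k\<close> and \<open>\<nu> s l k d\<close> stand
  for \<open>\<alpha>\<^sub>s\<close> and its disaggregated copy for disjunct \<open>d\<close>, both belonging to constraint \<open>k\<close> of disjunct
  \<open>l\<close>.  Values at indices out of range are unconstrained and irrelevant.  The parameter \<open>\<Lambda>\<close> is the
  domain of the indicator variables: \<open>{0, 1}\<close> for the formulation proper and \<open>{0..1}\<close> for its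
  continuous relaxation.
\<close>

definition psplit_feasible ::
    "real set \<Rightarrow> (real^'n) set \<Rightarrow> ('n \<Rightarrow> 'k \<Rightarrow> real \<Rightarrow> real) \<Rightarrow> 'd set \<Rightarrow> ('d \<Rightarrow> 'k set)
      \<Rightarrow> ('d \<Rightarrow> 'k \<Rightarrow> real) \<Rightarrow> nat \<Rightarrow> (nat \<Rightarrow> 'n set)
      \<Rightarrow> ((real^'n) \<times> (nat \<Rightarrow> 'd \<Rightarrow> 'k \<Rightarrow> real) \<times> (nat \<Rightarrow> 'd \<Rightarrow> 'k \<Rightarrow> 'd \<Rightarrow> real)
          \<times> ('d \<Rightarrow> real)) set" where
  "psplit_feasible \<Lambda> B h D C b P I = {(x, \<alpha>, \<nu>, lam). x \<in> B \<and>
     (\<forall>d\<in>D. lam d \<in> \<Lambda>) \<and> (\<Sum>d\<in>D. lam d) = 1 \<and>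
     (\<forall>l\<in>D. \<forall>k\<in>C l.
        (\<Sum>s=1..P. \<nu> s l k l) \<le> b l k * lam l \<and>
        (\<forall>s\<in>{1..P}.
           \<alpha> s l k = (\<Sum>d\<in>D. \<nu> s l k d) \<and>
           (\<forall>d\<in>D. (INF y\<in>B. env_sum B h (I s) k y) * lam d \<le> \<nu> s l k d \<and>
                   \<nu> s l k d \<le> (SUP y\<in>B. env_sum B h (I s) k y) * lam d) \<and>
           env_sum B h (I s) k x \<le> \<alpha> s l k))}"

abbreviation psplit_formulation where
  "psplit_formulation \<equiv> psplit_feasible {0, 1}"

abbreviation psplit_relaxation where
  "psplit_relaxation \<equiv> psplit_feasible {0..1}"

definition bigM_coeff ::
    "(real^'n) set \<Rightarrow> ('n \<Rightarrow> 'k \<Rightarrow> real \<Rightarrow> real) \<Rightarrow> ('d \<Rightarrow> 'k \<Rightarrow> real) \<Rightarrow> 'd \<Rightarrow> 'k \<Rightarrow> real" where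
  "bigM_coeff B h b l k = (SUP y\<in>B. env_sum B h UNIV k y) - b l k"

definition bigM_feasible ::
    "real set \<Rightarrow> (real^'n) set \<Rightarrow> ('n \<Rightarrow> 'k \<Rightarrow> real \<Rightarrow> real) \<Rightarrow> 'd set \<Rightarrow> ('d \<Rightarrow> 'k set)
      \<Rightarrow> ('d \<Rightarrow> 'k \<Rightarrow> real) \<Rightarrow> ((real^'n) \<times> ('d \<Rightarrow> real)) set" where
  "bigM_feasible \<Lambda> B h D C b = {(x, lam). x \<in> B \<and>
     (\<forall>d\<in>D. lam d \<in> \<Lambda>) \<and> (\<Sum>d\<in>D. lam d) = 1 \<and>
     (\<forall>l\<in>D. \<forall>k\<in>C l.
        env_sum B h UNIV k x \<le> b l k + bigM_coeff B h b l k * (1 - lam l))}"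

abbreviation bigM_formulation where
  "bigM_formulation \<equiv> bigM_feasible {0, 1}"

abbreviation bigM_relaxation where
  "bigM_relaxation \<equiv> bigM_feasible {0..1}"

definition additive_bounds ::
    "(real^'n) set \<Rightarrow> ('n \<Rightarrow> 'k \<Rightarrow> real \<Rightarrow> real) \<Rightarrow> 'k set \<Rightarrow> bool" where
  "additive_bounds B h K \<longleftrightarrow> (\<forall>k\<in>K. \<forall>I I'. I \<inter> I' = {} \<longrightarrow>
     (INF x\<in>B. env_sum B h I k x + env_sum B h I' k x)
       = (INF x\<in>B. env_sum B h I k x) + (INF x\<in>B. env_sum B h I' k x) \<and>
     (SUP x\<in>B. env_sum B h I k x + env_sum B h I' k x)
       = (SUP x\<in>B. env_sum B h I k x) + (SUP x\<in>B. env_sum B h I' k x))"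

end

theory Submission imports Defs begin

text \<open>
  \<^bold>\<open>The \<open>1\<close>-split.\<close> Summing the upper bounds on the disaggregated variables \<open>\<nu>\<^sub>d\<close>, \<open>d \<noteq> l\<close>, and
  the constraint \<open>\<nu>\<^sub>l \<le> b \<lambda>\<^sub>l\<close> turns \<open>H x \<le> \<Sum>\<^sub>d \<nu>\<^sub>d\<close> into \<open>H x \<le> b \<lambda>\<^sub>l + (sup H) (1 - \<lambda>\<^sub>l)\<close>, which is
  the big-M constraint.  Conversely every \<open>\<nu>\<^sub>d\<close> may be put at the largest value that its constraints
  permit; nonemptiness of the disjuncts ensures that this value respects the lower bound.
  So the two relaxations agree even for each fixed choice of the indicators
  (\<open>one_split_feasible_iff_bigM_feasible\<close>).

  \<^bold>\<open>Refining a split.\<close> If group \<open>j\<close> is split into groups \<open>t\<close> and \<open>u\<close>, a point of the finer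
  relaxation is mapped to a point of the coarser one by adding the variables of \<open>t\<close> and \<open>u\<close>.  The
  constraint on \<open>\<alpha>\<^sub>j\<close> survives this because over a box the convex envelope of a sum of functions of
  disjoint groups of coordinates is the sum of the envelopes (\<open>env_sum_Un\<close>).  With this identity,
  additivity of the bounds says that the bounds on the variables of group \<open>j\<close> are the sums
  of those of \<open>t\<close> and \<open>u\<close>.
\<close>

section \<open>Convex envelopes of separable sums\<close>

definition mix :: "'n set \<Rightarrow> real^'n \<Rightarrow> real^'n \<Rightarrow> real^'n" where
  "mix T y z = (\<chi> i. if i \<in> T then y $ i else z $ i)"

lemma mix_nth [simp]: "mix T y z $ i = (if i \<in> T then y $ i else z $ i)"
  by (simp add: mix_def)

lemma mix_same [simp]: "mix T x x = x"
  by (simp add: vec_eq_iff)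

lemma mix_in_cbox: "y \<in> cbox lo up \<Longrightarrow> z \<in> cbox lo up \<Longrightarrow> mix T y z \<in> cbox lo up"
  by (simp add: mem_box_cart)

lemma convex_on_mix:
  assumes G: "convex_on S G" and mix: "\<And>y z. y \<in> S \<Longrightarrow> z \<in> S \<Longrightarrow> mix T y z \<in> S"
  shows "z \<in> S \<Longrightarrow> convex_on S (\<lambda>y. G (mix T y z))"
    and "y \<in> S \<Longrightarrow> convex_on S (\<lambda>z. G (mix T y z))"
proof -
  have S: "convex S"
    using G by (rule convex_on_imp_convex)
  show "convex_on S (\<lambda>y. G (mix T y z))" if "z \<in> S"
  proof (rule convex_onI[OF _ S])
    fix t :: real and v w
    assume t: "0 < t" "t < 1" and vw: "v \<in> S" "w \<in> S"
    have "mix T ((1 - t) *\<^sub>R v + t *\<^sub>R w) z = (1 - t) *\<^sub>R mix T v z + t *\<^sub>R mix T w z"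
      by (auto simp: vec_eq_iff algebra_simps)
    then show "G (mix T ((1 - t) *\<^sub>R v + t *\<^sub>R w) z) \<le> (1 - t) * G (mix T v z) + t * G (mix T w z)"
      using convex_onD[OF G] t vw that mix by simp
  qed
  show "convex_on S (\<lambda>z. G (mix T y z))" if "y \<in> S"
  proof (rule convex_onI[OF _ S])
    fix t :: real and v w
    assume t: "0 < t" "t < 1" and vw: "v \<in> S" "w \<in> S"
    have "mix T y ((1 - t) *\<^sub>R v + t *\<^sub>R w) = (1 - t) *\<^sub>R mix T y v + t *\<^sub>R mix T y w"
      by (auto simp: vec_eq_iff algebra_simps)
    then show "G (mix T y ((1 - t) *\<^sub>R v + t *\<^sub>R w)) \<le> (1 - t) * G (mix T y v) + t * G (mix T y w)"
      using convex_onD[OF G] t vw that mix by simp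
  qed
qed

text \<open>
  The envelope of the sum is taken at \<open>mix T y z\<close> and bounded in one block of coordinates at a time:
  with \<open>z\<close> fixed, subtracting \<open>g z\<close> leaves a convex minorant of \<open>f\<close> in \<open>y\<close>; with \<open>y\<close> fixed,
  subtracting the envelope of \<open>f\<close> then leaves a convex minorant of \<open>g\<close> in \<open>z\<close>.
\<close>

lemma convenv_add:
  assumes S: "convex S" and bdd: "bdd_below (f ` S)" "bdd_below (g ` S)"
    and mix: "\<And>y z. y \<in> S \<Longrightarrow> z \<in> S \<Longrightarrow> mix T y z \<in> S"
    and f: "\<And>y z. y \<in> S \<Longrightarrow> z \<in> S \<Longrightarrow> f (mix T y z) = f y"
    and g: "\<And>y z. y \<in> S \<Longrightarrow> z \<in> S \<Longrightarrow> g (mix T y z) = g z"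
    and x: "x \<in> S"
  shows "convenv S (\<lambda>x. f x + g x) x = convenv S f x + convenv S g x"
proof (rule antisym)
  let ?G = "convenv S (\<lambda>x. f x + g x)"
  have "bdd_below ((\<lambda>x. f x + g x) ` S)"
  proof -
    obtain a c where "\<And>y. y \<in> S \<Longrightarrow> a \<le> f y" "\<And>y. y \<in> S \<Longrightarrow> c \<le> g y"
      using bdd by (auto simp: bdd_below_def)
    then show ?thesis
      by (intro bdd_belowI2[where m = "a + c"]) (simp add: add_mono)
  qed
  then have G: "convex_on S ?G" and G_le: "\<And>y. y \<in> S \<Longrightarrow> ?G y \<le> f y + g y"
    using S convex_on_convenv convenv_le by blast+
  have "?G (mix T y z) - g z \<le> convenv S f y" if "y \<in> S" "z \<in> S" for y z
  proof (rule convenv_greatest[OF _ _ \<open>y \<in> S\<close>])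
    show "convex_on S (\<lambda>y. ?G (mix T y z) - g z)"
      using convex_on_add[OF convex_on_mix(1)[where T = T, OF G _ \<open>z \<in> S\<close>], of "\<lambda>_. - g z"] S mix
      by (simp add: convex_on_const)
    show "?G (mix T y' z) - g z \<le> f y'" if "y' \<in> S" for y'
      using G_le[OF mix[OF that \<open>z \<in> S\<close>]] f g that \<open>z \<in> S\<close> by simp
  qed
  then have step: "?G (mix T y z) - convenv S f y \<le> g z" if "y \<in> S" "z \<in> S" for y z
    using that by (force simp: algebra_simps)
  have "?G (mix T x x) - convenv S f x \<le> convenv S g x"
  proof (rule convenv_greatest[where g = "\<lambda>z. ?G (mix T x z) - convenv S f x", OF _ _ x])
    show "convex_on S (\<lambda>z. ?G (mix T x z) - convenv S f x)"
      using convex_on_add[OF convex_on_mix(2)[where T = T, OF G _ x], of "\<lambda>_. - convenv S f x"] S mix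
      by (simp add: convex_on_const)
  qed (use step x in auto)
  then show "?G x \<le> convenv S f x + convenv S g x"
    by simp
next
  show "convenv S f x + convenv S g x \<le> convenv S (\<lambda>x. f x + g x) x"
    by (intro convenv_greatest[OF _ _ x] convex_on_add convex_on_convenv S bdd
        add_mono convenv_le)
qed

lemma bounded_sum_coords:
  fixes h :: "'n::finite \<Rightarrow> 'k \<Rightarrow> real \<Rightarrow> real"
  assumes "\<And>i. bounded ((\<lambda>x. h i k (x $ i)) ` B)"
  shows "bounded ((\<lambda>x. \<Sum>i\<in>I. h i k (x $ i)) ` B)"
proof -
  obtain c where c: "\<And>i x. x \<in> B \<Longrightarrow> \<bar>h i k (x $ i)\<bar> \<le> c i"
    using assms unfolding bounded_iff by simp metis
  have "\<bar>\<Sum>i\<in>I. h i k (x $ i)\<bar> \<le> (\<Sum>i\<in>I. c i)" if "x \<in> B" for x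
    using c that by (intro order_trans[OF sum_abs] sum_mono)
  then show ?thesis
    unfolding bounded_iff by auto
qed

lemma env_sum_Un:
  assumes "\<And>i. bounded ((\<lambda>x. h i k (x $ i)) ` cbox lo up)"
    and "T \<inter> U = {}" and "x \<in> cbox lo up"
  shows "env_sum (cbox lo up) h (T \<union> U) k x
    = env_sum (cbox lo up) h T k x + env_sum (cbox lo up) h U k x"
proof -
  have "(\<lambda>x. \<Sum>i\<in>T \<union> U. h i k (x $ i)) = (\<lambda>x. (\<Sum>i\<in>T. h i k (x $ i)) + (\<Sum>i\<in>U. h i k (x $ i)))"
    using assms(2) by (simp add: sum.union_disjoint)
  then show ?thesis
    unfolding env_sum_def using assms
    by (simp, intro convenv_add[where T = T] convex_box bounded_imp_bdd_below bounded_sum_coords mix_in_cbox)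
      (auto intro!: sum.cong)
qed

text \<open>The lower bound is inherited because constants are convex.\<close>

lemma bounded_convenv:
  assumes S: "convex S" and f: "bounded (f ` S)"
  shows "bounded (convenv S f ` S)"
proof -
  obtain c where c: "\<And>x. x \<in> S \<Longrightarrow> \<bar>f x\<bar> \<le> c"
    using f unfolding bounded_iff by auto
  have "- c \<le> convenv S f x" if "x \<in> S" for x
    using c S that by (intro convenv_greatest[where g = "\<lambda>_. - c"])
      (auto simp: convex_on_const abs_le_iff minus_le_iff)
  moreover have "convenv S f x \<le> c" if "x \<in> S" for x
    using convenv_le[OF S bounded_imp_bdd_below[OF f] that] c[OF that] by simp
  ultimately have "\<bar>convenv S f x\<bar> \<le> c" if "x \<in> S" for x
    using that by (simp add: abs_le_iff minus_le_iff)
  then show ?thesis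
    unfolding bounded_iff by auto
qed

lemma bounded_env_sum:
  assumes "convex B" and "\<And>i. bounded ((\<lambda>x. h i k (x $ i)) ` B)"
  shows "bounded (env_sum B h I k ` B)"
  unfolding env_sum_def using assms by (intro bounded_convenv bounded_sum_coords)

section \<open>The 1-split and the big-M formulation\<close>

text \<open>
  The witness puts \<open>\<nu>\<^sub>d\<close> at its upper bound for \<open>d \<noteq> l\<close>, while \<open>\<nu>\<^sub>l\<close> is also capped by
  \<open>b \<lambda>\<^sub>l\<close>.  If the cap is inactive, then \<open>\<alpha>\<close> equals the supremum of the envelope.  Otherwise
  \<open>\<alpha>\<close> equals the right-hand side of the big-M constraint.
\<close>

lemma one_split_feasible_iff_bigM_feasible:
  assumes D: "finite D" and \<Lambda>: "\<Lambda> \<subseteq> {0..}" and B: "convex B"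
    and h: "\<And>i l k. l \<in> D \<Longrightarrow> k \<in> C l \<Longrightarrow> bounded ((\<lambda>x. h i k (x $ i)) ` B)"
    and ne: "\<And>l. l \<in> D \<Longrightarrow> disjunct B h C b l \<noteq> {}"
    and I: "I 1 = UNIV"
  shows "(\<exists>\<alpha> \<nu>. (x, \<alpha>, \<nu>, lam) \<in> psplit_feasible \<Lambda> B h D C b 1 I)
    \<longleftrightarrow> (x, lam) \<in> bigM_feasible \<Lambda> B h D C b"
proof -
  let ?H = "env_sum B h UNIV"
  let ?m = "\<lambda>k. INF y\<in>B. ?H k y" and ?M = "\<lambda>k. SUP y\<in>B. ?H k y"
  have bdd: "bounded (?H k ` B)" if "l \<in> D" "k \<in> C l" for l k
    using h[OF that] by (rule bounded_env_sum[OF B])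
  have le_M: "?H k y \<le> ?M k" and m_le: "?m k \<le> ?H k y" if "y \<in> B" "l \<in> D" "k \<in> C l" for y l k
    using that bdd by (auto intro!: cSUP_upper cINF_lower bounded_imp_bdd_above bounded_imp_bdd_below)
  have m_le_b: "?m k \<le> b l k" if "l \<in> D" "k \<in> C l" for l k
  proof -
    obtain y where "y \<in> B" "?H k y \<le> b l k"
      using ne[OF \<open>l \<in> D\<close>] \<open>k \<in> C l\<close> unfolding disjunct_def by auto
    then show ?thesis
      using m_le that by (meson order_trans)
  qed
  show ?thesis
  proof
    assume "\<exists>\<alpha> \<nu>. (x, \<alpha>, \<nu>, lam) \<in> psplit_feasible \<Lambda> B h D C b 1 I"
    then obtain \<alpha> \<nu> where feas: "(x, \<alpha>, \<nu>, lam) \<in> psplit_feasible \<Lambda> B h D C b 1 I"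
      by blast
    then have x: "x \<in> B" and lam: "\<forall>d\<in>D. lam d \<in> \<Lambda>" "(\<Sum>d\<in>D. lam d) = 1"
      by (auto simp: psplit_feasible_def)
    have "?H k x \<le> b l k + bigM_coeff B h b l k * (1 - lam l)" if lk: "l \<in> D" "k \<in> C l" for l k
    proof -
      have cap: "\<nu> 1 l k l \<le> b l k * lam l"
        and bound: "\<And>d. d \<in> D \<Longrightarrow> \<nu> 1 l k d \<le> ?M k * lam d"
        and \<alpha>: "\<alpha> 1 l k = (\<Sum>d\<in>D. \<nu> 1 l k d)" and H: "?H k x \<le> \<alpha> 1 l k"
        using feas lk unfolding psplit_feasible_def mem_Collect_eq case_prod_conv
        by (force simp: I[simplified])+
      note H
      also note \<alpha>
      also have "(\<Sum>d\<in>D. \<nu> 1 l k d) = \<nu> 1 l k l + (\<Sum>d\<in>D - {l}. \<nu> 1 l k d)"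
        using D lk by (simp add: sum.remove)
      also have "\<dots> \<le> b l k * lam l + (\<Sum>d\<in>D - {l}. ?M k * lam d)"
        using cap bound by (intro add_mono sum_mono) auto
      also have "(\<Sum>d\<in>D - {l}. ?M k * lam d) = ?M k * (1 - lam l)"
        using D lk lam(2) by (simp add: sum_distrib_left[symmetric] sum.remove[of D l])
      also have "b l k * lam l + ?M k * (1 - lam l) = b l k + bigM_coeff B h b l k * (1 - lam l)"
        by (simp add: bigM_coeff_def algebra_simps)
      finally show ?thesis .
    qed
    then show "(x, lam) \<in> bigM_feasible \<Lambda> B h D C b"
      using x lam by (auto simp: bigM_feasible_def)
  next
    assume feas: "(x, lam) \<in> bigM_feasible \<Lambda> B h D C b"
    then have x: "x \<in> B" and lam: "\<forall>d\<in>D. lam d \<in> \<Lambda>" "(\<Sum>d\<in>D. lam d) = 1"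
      by (auto simp: bigM_feasible_def)
    have lam_nonneg: "0 \<le> lam d" if "d \<in> D" for d
      using lam \<Lambda> that by auto
    define \<nu> where
      "\<nu> = (\<lambda>(s::nat) l k d. (if d = l then min (b l k) (?M k) else ?M k) * lam d)"
    have cap: "\<nu> 1 l k l \<le> b l k * lam l" if "l \<in> D" "k \<in> C l" for l k
      using lam_nonneg that by (auto simp: \<nu>_def intro!: mult_right_mono)
    have bounds: "?m k * lam d \<le> \<nu> 1 l k d \<and> \<nu> 1 l k d \<le> ?M k * lam d"
      if lk: "l \<in> D" "k \<in> C l" and d: "d \<in> D" for l k d
    proof -
      have "?m k \<le> ?M k"
        using le_M[OF x lk] m_le[OF x lk] by linarith
      then show ?thesis
        using lam_nonneg[OF d] m_le_b[OF lk] by (auto simp: \<nu>_def intro!: mult_right_mono)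
    qed
    have "?H k x \<le> (\<Sum>d\<in>D. \<nu> 1 l k d)" if lk: "l \<in> D" "k \<in> C l" for l k
    proof -
      have "(\<Sum>d\<in>D. \<nu> 1 l k d) = \<nu> 1 l k l + (\<Sum>d\<in>D - {l}. \<nu> 1 l k d)"
        using D lk by (simp add: sum.remove)
      also have "(\<Sum>d\<in>D - {l}. \<nu> 1 l k d) = (\<Sum>d\<in>D - {l}. ?M k * lam d)"
        by (auto simp: \<nu>_def intro!: sum.cong)
      also have "\<dots> = ?M k * (1 - lam l)"
        using D lk lam(2) by (simp add: sum_distrib_left[symmetric] sum.remove[of D l])
      finally have sum: "(\<Sum>d\<in>D. \<nu> 1 l k d) = min (b l k) (?M k) * lam l + ?M k * (1 - lam l)"
        by (simp add: \<nu>_def)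
      have "?H k x \<le> b l k + bigM_coeff B h b l k * (1 - lam l)"
        using feas lk by (auto simp: bigM_feasible_def)
      then have "?H k x \<le> b l k * lam l + ?M k * (1 - lam l)"
        by (simp add: bigM_coeff_def algebra_simps)
      moreover have "?H k x \<le> ?M k * lam l + ?M k * (1 - lam l)"
        using le_M[OF x lk] by (simp add: algebra_simps)
      ultimately show ?thesis
        unfolding sum by (simp add: min_def)
    qed
    then have "(x, \<lambda>s l k. \<Sum>d\<in>D. \<nu> s l k d, \<nu>, lam) \<in> psplit_feasible \<Lambda> B h D C b 1 I"
      using x lam cap bounds I by (simp add: psplit_feasible_def)
    then show "\<exists>\<alpha> \<nu>. (x, \<alpha>, \<nu>, lam) \<in> psplit_feasible \<Lambda> B h D C b 1 I"
      by blast
  qed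
qed

section \<open>Refining a split\<close>

lemma is_split_inj_on: "is_split P I \<Longrightarrow> inj_on I {1..P}"
  unfolding is_split_def disjoint_family_on_def inj_on_def by (metis inf.idem)

lemma splits_one_group_bij:
  assumes "splits_one_group P I J"
  obtains j t u \<sigma> where
    "j \<in> {1..P}" "t \<in> {1..P+1}" "u \<in> {1..P+1}" "t \<noteq> u"
    "J t \<union> J u = I j" "J t \<inter> J u = {}"
    "bij_betw \<sigma> ({1..P} - {j}) ({1..P+1} - {t, u})"
    "\<And>s. s \<in> {1..P} - {j} \<Longrightarrow> J (\<sigma> s) = I s"
proof -
  obtain j t u where j: "j \<in> {1..P}" and tu: "t \<in> {1..P+1}" "u \<in> {1..P+1}" "t \<noteq> u"
    and Un: "J t \<union> J u = I j" and img: "J ` ({1..P+1} - {t, u}) = I ` ({1..P} - {j})"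
    and I: "is_split P I" and J: "is_split (P + 1) J"
    using assms unfolding splits_one_group_def by blast
  let ?A = "{1..P} - {j}" and ?A' = "{1..P+1} - {t, u}"
  have "bij_betw I ?A (I ` ?A)"
    using is_split_inj_on[OF I] by (meson Diff_subset inj_on_imp_bij_betw inj_on_subset)
  moreover have J': "bij_betw J ?A' (I ` ?A)"
    using is_split_inj_on[OF J] img by (metis Diff_subset inj_on_imp_bij_betw inj_on_subset)
  ultimately have "bij_betw (inv_into ?A' J \<circ> I) ?A ?A'"
    using bij_betw_trans bij_betw_inv_into by blast
  moreover have "J ((inv_into ?A' J \<circ> I) s) = I s" if "s \<in> ?A" for s
    using bij_betw_inv_into_right[OF J'] that by simp
  moreover have "J t \<inter> J u = {}"
    using J tu unfolding is_split_def disjoint_family_on_def by blast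
  ultimately show ?thesis
    using that j tu Un by blast
qed

text \<open>
  The bijection \<open>\<sigma>\<close> between the groups common to both splits transports the variables of these
  groups; only group \<open>j\<close>, which receives the sums of the variables of \<open>t\<close> and \<open>u\<close>, needs an argument.
\<close>

lemma psplit_feasible_refine:
  assumes h: "\<And>i l k. l \<in> D \<Longrightarrow> k \<in> C l \<Longrightarrow> bounded ((\<lambda>x. h i k (x $ i)) ` cbox lo up)"
    and add: "additive_bounds (cbox lo up) h (\<Union>l\<in>D. C l)"
    and split: "splits_one_group P I J"
  shows "fst ` psplit_feasible \<Lambda> (cbox lo up) h D C b (P + 1) J
    \<subseteq> fst ` psplit_feasible \<Lambda> (cbox lo up) h D C b P I"
proof clarsimp
  let ?B = "cbox lo up"
  fix x \<alpha> \<nu> lam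
  assume "(x, \<alpha>, \<nu>, lam) \<in> psplit_feasible \<Lambda> ?B h D C b (Suc P) J"
  then have x: "x \<in> ?B" and lam: "\<forall>d\<in>D. lam d \<in> \<Lambda>" "(\<Sum>d\<in>D. lam d) = 1"
    and cap: "\<And>l k. l \<in> D \<Longrightarrow> k \<in> C l \<Longrightarrow> (\<Sum>s=1..P+1. \<nu> s l k l) \<le> b l k * lam l"
    and \<alpha>: "\<And>l k s. l \<in> D \<Longrightarrow> k \<in> C l \<Longrightarrow> s \<in> {1..P+1} \<Longrightarrow> \<alpha> s l k = (\<Sum>d\<in>D. \<nu> s l k d)"
    and lb: "\<And>l k s d. l \<in> D \<Longrightarrow> k \<in> C l \<Longrightarrow> s \<in> {1..P+1} \<Longrightarrow> d \<in> D \<Longrightarrow>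
      (INF y\<in>?B. env_sum ?B h (J s) k y) * lam d \<le> \<nu> s l k d"
    and ub: "\<And>l k s d. l \<in> D \<Longrightarrow> k \<in> C l \<Longrightarrow> s \<in> {1..P+1} \<Longrightarrow> d \<in> D \<Longrightarrow>
      \<nu> s l k d \<le> (SUP y\<in>?B. env_sum ?B h (J s) k y) * lam d"
    and env: "\<And>l k s. l \<in> D \<Longrightarrow> k \<in> C l \<Longrightarrow> s \<in> {1..P+1} \<Longrightarrow> env_sum ?B h (J s) k x \<le> \<alpha> s l k"
    unfolding psplit_feasible_def mem_Collect_eq case_prod_conv Suc_eq_plus1 by blast+
  obtain j t u \<sigma> where j: "j \<in> {1..P}" and t: "t \<in> {1..P+1}" and u: "u \<in> {1..P+1}"
    and tu: "t \<noteq> u" "J t \<union> J u = I j" "J t \<inter> J u = {}"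
    and \<sigma>: "bij_betw \<sigma> ({1..P} - {j}) ({1..P+1} - {t, u})"
    and J: "\<And>s. s \<in> {1..P} - {j} \<Longrightarrow> J (\<sigma> s) = I s"
    using splits_one_group_bij[OF split] by blast
  have \<sigma>_mem: "\<sigma> s \<in> {1..P+1}" if "s \<in> {1..P}" "s \<noteq> j" for s
    using bij_betwE[OF \<sigma>] that by blast
  have env_j: "env_sum ?B h (I j) k y = env_sum ?B h (J t) k y + env_sum ?B h (J u) k y"
    if "l \<in> D" "k \<in> C l" "y \<in> ?B" for l k y
    using env_sum_Un[of h k lo up "J t" "J u" y] h tu that by simp
  have bounds_j:
    "(INF y\<in>?B. env_sum ?B h (I j) k y)
      = (INF y\<in>?B. env_sum ?B h (J t) k y) + (INF y\<in>?B. env_sum ?B h (J u) k y)"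
    "(SUP y\<in>?B. env_sum ?B h (I j) k y)
      = (SUP y\<in>?B. env_sum ?B h (J t) k y) + (SUP y\<in>?B. env_sum ?B h (J u) k y)"
    if "l \<in> D" "k \<in> C l" for l k
    using add that tu env_j[OF that] unfolding additive_bounds_def by (auto cong: INF_cong SUP_cong)
  define \<alpha>' where "\<alpha>' = (\<lambda>s. if s = j then (\<lambda>l k. \<alpha> t l k + \<alpha> u l k) else \<alpha> (\<sigma> s))"
  define \<nu>' where "\<nu>' = (\<lambda>s. if s = j then (\<lambda>l k d. \<nu> t l k d + \<nu> u l k d) else \<nu> (\<sigma> s))"
  have "(x, \<alpha>', \<nu>', lam) \<in> psplit_feasible \<Lambda> ?B h D C b P I"
    unfolding psplit_feasible_def
  proof (clarsimp simp: x lam simp del: mem_box_cart, intro ballI conjI)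
    fix l k
    assume lk: "l \<in> D" "k \<in> C l"
    have "(\<Sum>s=1..P. \<nu>' s l k l) = \<nu>' j l k l + (\<Sum>s\<in>{1..P} - {j}. \<nu>' s l k l)"
      using j by (simp add: sum.remove)
    also have "(\<Sum>s\<in>{1..P} - {j}. \<nu>' s l k l) = (\<Sum>s\<in>{1..P} - {j}. \<nu> (\<sigma> s) l k l)"
      by (auto simp: \<nu>'_def intro!: sum.cong)
    also have "\<dots> = (\<Sum>s\<in>{1..P+1} - {t, u}. \<nu> s l k l)"
      using \<sigma> by (rule sum.reindex_bij_betw)
    also have "\<nu>' j l k l + \<dots> = (\<Sum>s\<in>{t, u}. \<nu> s l k l) + (\<Sum>s\<in>{1..P+1} - {t, u}. \<nu> s l k l)"
      using tu by (simp add: \<nu>'_def)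
    also have "\<dots> = (\<Sum>s=1..P+1. \<nu> s l k l)"
      using t u by (metis (no_types, lifting) add.commute empty_subsetI finite_atLeastAtMost insert_subset
          sum.subset_diff)
    also have "\<dots> \<le> b l k * lam l"
      using cap lk .
    finally show "(\<Sum>s=Suc 0..P. \<nu>' s l k l) \<le> b l k * lam l"
      by simp
    fix s
    assume s: "s \<in> {Suc 0..P}"
    show "\<alpha>' s l k = (\<Sum>d\<in>D. \<nu>' s l k d)"
      using \<alpha>[OF lk] t u \<sigma>_mem[of s] s by (simp add: \<alpha>'_def \<nu>'_def sum.distrib)
    show "env_sum ?B h (I s) k x \<le> \<alpha>' s l k"
      using env[OF lk t] env[OF lk u] env[OF lk \<sigma>_mem] env_j[OF lk x] J[of s] s
      by (force simp: \<alpha>'_def)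
    fix d
    assume d: "d \<in> D"
    show "(INF y\<in>?B. env_sum ?B h (I s) k y) * lam d \<le> \<nu>' s l k d"
      using lb[OF lk t d] lb[OF lk u d] lb[OF lk \<sigma>_mem d] bounds_j(1)[OF lk] J[of s] s
      by (force simp: \<nu>'_def distrib_right)
    show "\<nu>' s l k d \<le> (SUP y\<in>?B. env_sum ?B h (I s) k y) * lam d"
      using ub[OF lk t d] ub[OF lk u d] ub[OF lk \<sigma>_mem d] bounds_j(2)[OF lk] J[of s] s
      by (force simp: \<nu>'_def distrib_right)
  qed
  then show "x \<in> fst ` psplit_feasible \<Lambda> ?B h D C b P I"
    by force
qed

theorem corollary4:
  fixes lo up :: "real^'n" and B :: "(real^'n) set"
    and D :: "'d set" and C :: "'d \<Rightarrow> 'k set"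
    and h :: "'n \<Rightarrow> 'k \<Rightarrow> real \<Rightarrow> real" and b :: "'d \<Rightarrow> 'k \<Rightarrow> real"
  assumes "B = cbox lo up"
    and "finite D"
    and "\<And>l. l \<in> D \<Longrightarrow> finite (C l)"
    and "\<And>i l k. l \<in> D \<Longrightarrow> k \<in> C l \<Longrightarrow> bounded ((\<lambda>x. h i k (x $ i)) ` B)"
    and "\<And>l. l \<in> D \<Longrightarrow> disjunct B h C b l \<noteq> {}"
  shows "(\<forall>I. is_split 1 I \<longrightarrow>
            fst ` psplit_relaxation B h D C b 1 I = fst ` bigM_relaxation B h D C b) \<and>
         (additive_bounds B h (\<Union>l\<in>D. C l) \<longrightarrow>
            (\<forall>P I J. splits_one_group P I J \<longrightarrow>
               fst ` psplit_relaxation B h D C b (P + 1) J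
                 \<subseteq> fst ` psplit_relaxation B h D C b P I))"
proof (intro conjI allI impI)
  fix I :: "nat \<Rightarrow> 'n set"
  assume "is_split 1 I"
  then have I: "I 1 = UNIV"
    by (simp add: is_split_def)
  have "(\<exists>\<alpha> \<nu>. (x, \<alpha>, \<nu>, lam) \<in> psplit_relaxation B h D C b 1 I)
      \<longleftrightarrow> (x, lam) \<in> bigM_relaxation B h D C b" for x lam
    by (rule one_split_feasible_iff_bigM_feasible)
      (use assms I in \<open>auto simp: convex_box\<close>)
  then show "fst ` psplit_relaxation B h D C b 1 I = fst ` bigM_relaxation B h D C b"
    unfolding fst_eq_Domain Domain_unfold by (simp del: One_nat_def) metis
next
  fix P and I J :: "nat \<Rightarrow> 'n set"
  assume "additive_bounds B h (\<Union>l\<in>D. C l)" "splits_one_group P I J"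
  then show "fst ` psplit_relaxation B h D C b (P + 1) J \<subseteq> fst ` psplit_relaxation B h D C b P I"
    using psplit_feasible_refine assms(4) unfolding \<open>B = cbox lo up\<close> by blast
qed

end
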